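(* Consider a stochastic dynamic team with a partially nested information structure in which $\hat y^D_i=g_i(h_i(\zeta),u^{\downarrow i})$, and suppose that for all $i\in\mathcal{N}$ and every fixed $u^{\downarrow i}$ the function $g_i(\cdot,u^{\downarrow i}):h_i(\zeta)\mapsto\hat y^D_i$ is invertible for all realizations of $\zeta$. Then the static measurements with control-sharing reduction, from $(\mathcal{P}^{D,CS})$ to $(\mathcal{P}^{CS})$, is policy-independent: for each $i\in\mathcal{N}$, the policy $\gamma^{CS}_i$ satisfying $$\gamma^{D,CS}_i(y^{D,CS}_i)=\gamma^{CS}_i(y^{CS}_i)\quad\text{for every }u^{\downarrow i},\ P\text{-a.s.},$$ is constructed from $\gamma^{D,CS}_i$ in a way that does not depend on the policies of the preceding decision makers.
   Context: Setting. $\mathcal{N}=\{1,\dots,N\}$; the decision makers DM$^1,\dots,$DM$^N$ act in this order, each once. Action spaces $\mathbb{U}^i\subseteq\mathbb{R}^{n_i}$ and observation spaces are Borel subsets of Euclidean spaces. $\zeta=\{\omega_0,\dots,\omega_N\}$ is the collection of all primitive random variables on $(\Omega,\mathcal{F},P)$, $\omega_0$ taking values in a Borel space $\Omega_0$. The cost is a Borel function $c:\Omega_0\times\prod_i\mathbb{U}^i\to\mathbb{R}_+$, and $J(\underline\gamma)=E[c(\omega_0,u^1,\dots,u^N)]$ when actions are generated by $\underline\gamma$. All policies are deterministic. Observations. $y^D_i=\{y^D_{\downarrow i},\hat y^D_i\}$ with $\hat y^D_i=g_i(h_i(\zeta),u^{\downarrow i})$, where $g_i,h_i$ are measurable, $\downarrow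 i=\{j: \hat y^D_i\text{ is affected by }u^j\}$, $y^D_{\downarrow i}=(y^D_j)_{j\in\downarrow i}$, $u^{\downarrow i}=(u^j)_{j\in\downarrow i}$. The information structure is partially nested: whenever the action of DM$^k$, $k<i$, affects the information of DM$^i$, the information of DM$^i$ includes that of DM$^k$. Further, $y^S_i=\{y^S_{\downarrow i},\hat y^S_i\}$ with $\hat y^S_i=h_i(\zeta)$. Problem $(\mathcal{P}^{D,CS})$ (partially nested with control-sharing): DM$^i$ has information $y^{D,CS}_i=\{y^D_{\downarrow i},u^{\downarrow i},\hat y^D_i\}$ and uses a measurable policy $u^i=\gamma^{D,CS}_i(y^{D,CS}_i)$. Problem $(\mathcal{P}^{CS})$ (static measurements with control-sharing): DM$^i$ has information $y^{CS}_i=\{y^S_{\downarrow i},u^{\downarrow i},\hat y^S_i\}$ and uses a measurable policy $u^i=\gamma^{CS}_i(y^{CS}_i)$. Both problems have the expected cost $J$ with the same function $c$. The static measurements with control-sharing reduction is the passage from $(\mathcal{P}^{D,CS})$ to $(\mathcal{P}^{CS})$, with unaltered cost function, in which a policy $\underline\gamma^{D,CS}$ is transformed into a policy $\underline\gamma^{CS}$ with $\gamma^{D,CS}_i(y^{D,CS}_i)=\gamma^{CS}_i(y^{CS}_i)$ for every $u^{\downarrow i}$ $P$-a.s., for all $i\in\mathcal{N}$. Here, "for every $u^{\downarrow i}$" means that $u^{\downarrow i}$ is treated as a free variable entering both $y^{D,CS}_i$ (including through $\hat y^D_i$ and $y^D_{\downarrow i}$) and $y^{CS}_i$.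
   Formalization: Partial nestedness is read for the control-sharing information, so ↓k ⊆ ↓i is also required when u^k affects DM^i's information; otherwise (e.g. ŷ_2 = h_2+u^1, ŷ_3 = h_3+u^2) y^D_{↓3} involves u^1, which is not in u^{↓3}, and the claim fails. *)

theory Defs
  imports "HOL-Probability.Probability"
begin

text \<open>The dimensions vary with the decision maker, so a point of \<open>\<real>\<^sup>d\<close> is an extensional
  function on \<open>{..<d}\<close>; the product \<open>\<sigma>\<close>-algebra below is the Borel one.\<close>

type_synonym vec = "nat \<Rightarrow> real"

definition euclid :: "nat \<Rightarrow> vec measure" where
  "euclid d = (\<Pi>\<^sub>M k\<in>{..<d}. borel)"

text \<open>Decision makers are numbered \<open>1, \<dots>, num_DM\<close> and act in this order. \<open>base\<close> is
  \<open>(\<Omega>, F, P)\<close>; \<open>prim j\<close> is the primitive variable \<open>\<omega>\<^sub>j\<close>, with values in \<open>prim_set j\<close>.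
  \<open>meas i\<close> is \<open>h\<^sub>i\<close>, with values in \<open>stat_set i\<close>, and \<open>dyn i\<close> is \<open>g\<^sub>i\<close>, with values in
  \<open>obs_set i\<close>; the second argument of \<open>g\<^sub>i\<close> is a family indexed by \<open>down i\<close>.
  The single function \<open>cost\<close> serves both problems.\<close>

record ('w, 'z) team =
  base :: "'w measure"
  num_DM :: nat
  prim_set :: "nat \<Rightarrow> 'z set"
  prim :: "nat \<Rightarrow> 'w \<Rightarrow> 'z"
  act_dim :: "nat \<Rightarrow> nat"
  act_set :: "nat \<Rightarrow> vec set"
  stat_dim :: "nat \<Rightarrow> nat"
  stat_set :: "nat \<Rightarrow> vec set"
  obs_dim :: "nat \<Rightarrow> nat"
  obs_set :: "nat \<Rightarrow> vec set"
  down :: "nat \<Rightarrow> nat set"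
  meas :: "nat \<Rightarrow> (nat \<Rightarrow> 'z) \<Rightarrow> vec"
  dyn :: "nat \<Rightarrow> vec \<times> (nat \<Rightarrow> vec) \<Rightarrow> vec"
  cost :: "'z \<times> (nat \<Rightarrow> vec) \<Rightarrow> real"

definition DMs :: "('w, 'z) team \<Rightarrow> nat set" where
  "DMs T = {1..num_DM T}"

definition act_space :: "('w, 'z) team \<Rightarrow> nat \<Rightarrow> vec measure" where
  "act_space T i = restrict_space (euclid (act_dim T i)) (act_set T i)"

definition stat_space :: "('w, 'z) team \<Rightarrow> nat \<Rightarrow> vec measure" where
  "stat_space T i = restrict_space (euclid (stat_dim T i)) (stat_set T i)"

definition obs_space :: "('w, 'z) team \<Rightarrow> nat \<Rightarrow> vec measure" where
  "obs_space T i = restrict_space (euclid (obs_dim T i)) (obs_set T i)"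

definition prim_space :: "('w, 'z::polish_space) team \<Rightarrow> nat \<Rightarrow> 'z measure" where
  "prim_space T j = restrict_space borel (prim_set T j)"

definition acts_space :: "('w, 'z) team \<Rightarrow> nat set \<Rightarrow> (nat \<Rightarrow> vec) measure" where
  "acts_space T I = (\<Pi>\<^sub>M j\<in>I. act_space T j)"

definition zeta :: "('w, 'z) team \<Rightarrow> 'w \<Rightarrow> nat \<Rightarrow> 'z" where
  "zeta T \<omega> = (\<lambda>j\<in>{0..num_DM T}. prim T j \<omega>)"

definition yhat_S :: "('w, 'z) team \<Rightarrow> nat \<Rightarrow> 'w \<Rightarrow> vec" where
  "yhat_S T i \<omega> = meas T i (zeta T \<omega>)"

definition yhat_D :: "('w, 'z) team \<Rightarrow> nat \<Rightarrow> 'w \<Rightarrow> (nat \<Rightarrow> vec) \<Rightarrow> vec" where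
  "yhat_D T i \<omega> u = dyn T i (meas T i (zeta T \<omega>), restrict u (down T i))"

text \<open>Unfolding the recursion \<open>y\<^sub>i = {y\<^bsub>\<down>i\<^esub>, \<open>yhat\<close>\<^sub>i}\<close>, the collection \<open>y\<^sub>i\<close> consists of the
  \<open>yhat\<^sub>k\<close> for all \<open>k\<close> that are reached from \<open>i\<close> by iterating \<open>\<down>\<close> (including \<open>k = i\<close>).\<close>

definition obs_index :: "('w, 'z) team \<Rightarrow> nat \<Rightarrow> nat set" where
  "obs_index T i = {k. (k, i) \<in> {(j, m). j \<in> down T m}\<^sup>*}"

definition y_D :: "('w, 'z) team \<Rightarrow> nat \<Rightarrow> 'w \<Rightarrow> (nat \<Rightarrow> vec) \<Rightarrow> nat \<Rightarrow> vec" where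
  "y_D T i \<omega> u = (\<lambda>k\<in>obs_index T i. yhat_D T k \<omega> u)"

definition y_S :: "('w, 'z) team \<Rightarrow> nat \<Rightarrow> 'w \<Rightarrow> nat \<Rightarrow> vec" where
  "y_S T i \<omega> = (\<lambda>k\<in>obs_index T i. yhat_S T k \<omega>)"

definition y_DCS :: "('w, 'z) team \<Rightarrow> nat \<Rightarrow> 'w \<Rightarrow> (nat \<Rightarrow> vec) \<Rightarrow> (nat \<Rightarrow> vec) \<times> (nat \<Rightarrow> vec)" where
  "y_DCS T i \<omega> u = (y_D T i \<omega> u, restrict u (down T i))"

definition y_CS :: "('w, 'z) team \<Rightarrow> nat \<Rightarrow> 'w \<Rightarrow> (nat \<Rightarrow> vec) \<Rightarrow> (nat \<Rightarrow> vec) \<times> (nat \<Rightarrow> vec)" where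
  "y_CS T i \<omega> u = (y_S T i \<omega>, restrict u (down T i))"

definition affects :: "('w, 'z) team \<Rightarrow> nat \<Rightarrow> ('w \<Rightarrow> (nat \<Rightarrow> vec) \<Rightarrow> 'b) \<Rightarrow> bool" where
  "affects T k F \<longleftrightarrow>
    (\<exists>\<omega>\<in>space (base T). \<exists>u\<in>space (acts_space T (DMs T)). \<exists>u'\<in>space (acts_space T (DMs T)).
      (\<forall>j. j \<noteq> k \<longrightarrow> u j = u' j) \<and> F \<omega> u \<noteq> F \<omega> u')"

definition stochastic_team :: "('w, 'z::polish_space) team \<Rightarrow> bool" where
  "stochastic_team T \<longleftrightarrow>
    prob_space (base T) \<and>
    (\<forall>j\<in>{0..num_DM T}. prim_set T j \<in> sets borel \<and> prim T j \<in> base T \<rightarrow>\<^sub>M prim_space T j) \<and>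
    cost T \<in> borel_measurable (prim_space T 0 \<Otimes>\<^sub>M acts_space T (DMs T)) \<and>
    (\<forall>x\<in>space (prim_space T 0 \<Otimes>\<^sub>M acts_space T (DMs T)). cost T x \<ge> 0) \<and>
    (\<forall>i\<in>DMs T.
      act_set T i \<in> sets (euclid (act_dim T i)) \<and>
      stat_set T i \<in> sets (euclid (stat_dim T i)) \<and>
      obs_set T i \<in> sets (euclid (obs_dim T i)) \<and>
      down T i = {k \<in> DMs T. k < i \<and> affects T k (yhat_D T i)} \<and>
      meas T i \<in> (\<Pi>\<^sub>M j\<in>{0..num_DM T}. prim_space T j) \<rightarrow>\<^sub>M stat_space T i \<and>
      dyn T i \<in> stat_space T i \<Otimes>\<^sub>M acts_space T (down T i) \<rightarrow>\<^sub>M obs_space T i)"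

text \<open>Partial nestedness concerns the information structure \<open>y_DCS\<close> of the problem with
  control-sharing: "the information of \<open>i\<close> includes that of \<open>k\<close>" means that every observation
  and every action listed in \<open>y_DCS\<close> for \<open>k\<close> is listed in \<open>y_DCS\<close> for \<open>i\<close>. It yields
  \<open>down k \<subseteq> down i\<close> for every \<open>k \<in> down i\<close>, so that \<open>u\<^bsub>\<down>i\<^esub>\<close> determines all actions which enter
  \<open>y\<^bsub>\<down>i\<^esub>\<close>.\<close>

definition partially_nested :: "('w, 'z) team \<Rightarrow> bool" where
  "partially_nested T \<longleftrightarrow>
    (\<forall>i\<in>DMs T. \<forall>k\<in>DMs T. k < i \<and> affects T k (y_DCS T i) \<longrightarrow>
      obs_index T k \<subseteq> obs_index T i \<and> down T k \<subseteq> down T i)"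

definition invertible_observations :: "('w, 'z) team \<Rightarrow> bool" where
  "invertible_observations T \<longleftrightarrow>
    (\<forall>i\<in>DMs T. \<forall>v\<in>space (acts_space T (down T i)).
      inj_on (\<lambda>s. dyn T i (s, v)) (yhat_S T i ` space (base T)))"

type_synonym policy = "(nat \<Rightarrow> vec) \<times> (nat \<Rightarrow> vec) \<Rightarrow> vec"

definition policies_DCS :: "('w, 'z) team \<Rightarrow> (nat \<Rightarrow> policy) set" where
  "policies_DCS T = {\<gamma>. \<forall>i\<in>DMs T.
    \<gamma> i \<in> (\<Pi>\<^sub>M k\<in>obs_index T i. obs_space T k) \<Otimes>\<^sub>M acts_space T (down T i) \<rightarrow>\<^sub>M act_space T i}"

definition policies_CS :: "('w, 'z) team \<Rightarrow> (nat \<Rightarrow> policy) set" where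
  "policies_CS T = {\<gamma>. \<forall>i\<in>DMs T.
    \<gamma> i \<in> (\<Pi>\<^sub>M k\<in>obs_index T i. stat_space T k) \<Otimes>\<^sub>M acts_space T (down T i) \<rightarrow>\<^sub>M act_space T i}"

text \<open>The actions \<open>u\<close> are free here, not generated by a policy.\<close>

definition static_CS_reduction ::
  "('w, 'z) team \<Rightarrow> ((nat \<Rightarrow> policy) \<Rightarrow> nat \<Rightarrow> policy) \<Rightarrow> bool" where
  "static_CS_reduction T R \<longleftrightarrow>
    (\<forall>\<gamma>\<in>policies_DCS T. R \<gamma> \<in> policies_CS T \<and>
      (\<forall>i\<in>DMs T. \<forall>u\<in>space (acts_space T (down T i)).
        AE \<omega> in base T. \<gamma> i (y_DCS T i \<omega> u) = R \<gamma> i (y_CS T i \<omega> u)))"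

definition policy_independent ::
  "('w, 'z) team \<Rightarrow> ((nat \<Rightarrow> policy) \<Rightarrow> nat \<Rightarrow> policy) \<Rightarrow> bool" where
  "policy_independent T R \<longleftrightarrow>
    (\<exists>C. \<forall>\<gamma>\<in>policies_DCS T. \<forall>i\<in>DMs T. R \<gamma> i = C i (\<gamma> i))"

end

theory Submission
  imports Defs
begin

text \<open>For a fixed \<open>u\<^bsub>\<down>i\<^esub>\<close>, the static observations determine the dynamic ones through the maps
  \<open>g\<^sub>k\<close> with \<open>k = i\<close> or \<open>k\<close> an ancestor of \<open>i\<close>; partial nestedness gives \<open>\<down>k \<subseteq> \<down>i\<close>, so
  every action entering \<open>g\<^sub>k\<close> is available. The reduced policy is \<open>\<gamma>\<^sub>i\<close> precomposed with this
  reconstruction, which involves no policy at all. Uniqueness holds because the reduction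
  prescribes the value of the reduced policy at almost every realized observation.\<close>

definition dynamic_info ::
  "('w, 'z) team \<Rightarrow> nat \<Rightarrow> (nat \<Rightarrow> vec) \<times> (nat \<Rightarrow> vec) \<Rightarrow> (nat \<Rightarrow> vec) \<times> (nat \<Rightarrow> vec)" where
  "dynamic_info T i = (\<lambda>(s, v). (\<lambda>k\<in>obs_index T i. dyn T k (s k, restrict v (down T k)), v))"

lemma obs_index_refl: "i \<in> obs_index T i"
  by (simp add: obs_index_def)

text \<open>Bridges two notions: \<open>down\<close> is defined by influence on
  \<open>yhat_D\<close>, partial nestedness by influence on \<open>y_DCS\<close>. The former is the
  component at \<open>i\<close> of the latter's observation part.\<close>

lemma affects_y_DCS:
  assumes "affects T k (yhat_D T i)"
  shows "affects T k (y_DCS T i)"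
proof -
  have "yhat_D T i \<omega> u = fst (y_DCS T i \<omega> u) i" for \<omega> u
    by (simp add: y_DCS_def y_D_def obs_index_refl)
  with assms show ?thesis
    unfolding affects_def by metis
qed

lemma down_subset:
  assumes "stochastic_team T" "partially_nested T" "i \<in> DMs T" "k \<in> down T i"
  shows "k \<in> DMs T" "down T k \<subseteq> down T i"
proof -
  have k: "k \<in> DMs T" "k < i" "affects T k (yhat_D T i)"
    using assms by (auto simp: stochastic_team_def)
  then show "k \<in> DMs T" "down T k \<subseteq> down T i"
    using assms(2,3) affects_y_DCS[OF k(3)] unfolding partially_nested_def by blast+
qed

text \<open>Iterates \<open>down_subset\<close> along the chain from \<open>i\<close> down to
  \<open>k\<close>. Membership in \<open>DMs T\<close> is carried through the induction because
  \<open>down_subset\<close> requires it at each link.\<close>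

lemma obs_index_down_subset:
  assumes "stochastic_team T" "partially_nested T" "i \<in> DMs T" "k \<in> obs_index T i"
  shows "k \<in> DMs T \<and> down T k \<subseteq> down T i"
proof -
  from assms(4) have "(k, i) \<in> {(j, m). j \<in> down T m}\<^sup>*"
    by (simp add: obs_index_def)
  then show ?thesis
  proof (induction rule: converse_rtrancl_induct)
    case base
    then show ?case using assms by simp
  next
    case (step j m)
    then have "m \<in> DMs T" "j \<in> down T m" "down T m \<subseteq> down T i" by auto
    then show ?case using down_subset[OF assms(1,2)] by blast
  qed
qed

text \<open>The nested restrictions of \<open>u\<close> collapse since \<open>down T k\<close> lies
  in \<open>down T i\<close>. The identity is pointwise in \<open>\<omega>\<close> and
  \<open>u\<close>, with no null set excluded.\<close>

lemma dynamic_info_y_CS: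
  assumes "stochastic_team T" "partially_nested T" "i \<in> DMs T"
  shows "dynamic_info T i (y_CS T i \<omega> u) = y_DCS T i \<omega> u"
proof -
  have "restrict (restrict u (down T i)) (down T k) = restrict u (down T k)"
    if "k \<in> obs_index T i" for k
    using obs_index_down_subset[OF assms that] by (simp add: Int_absorb1)
  then show ?thesis
    by (auto simp: dynamic_info_def y_CS_def y_DCS_def y_S_def y_D_def yhat_S_def yhat_D_def
        intro!: restrict_ext)
qed

text \<open>Ensures that precomposition with \<open>dynamic_info\<close> turns admissible policies
  into admissible ones.\<close>

lemma measurable_dynamic_info:
  assumes "stochastic_team T" "partially_nested T" "i \<in> DMs T"
  shows "dynamic_info T i \<in>
    (\<Pi>\<^sub>M k\<in>obs_index T i. stat_space T k) \<Otimes>\<^sub>M acts_space T (down T i) \<rightarrow>\<^sub>M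
    (\<Pi>\<^sub>M k\<in>obs_index T i. obs_space T k) \<Otimes>\<^sub>M acts_space T (down T i)"
    (is "_ \<in> ?S \<Otimes>\<^sub>M ?A \<rightarrow>\<^sub>M _")
proof -
  have "(\<lambda>x. dyn T k (fst x k, restrict (snd x) (down T k))) \<in> ?S \<Otimes>\<^sub>M ?A \<rightarrow>\<^sub>M obs_space T k"
    if k: "k \<in> obs_index T i" for k
  proof -
    note sub = obs_index_down_subset[OF assms k]
    have d: "dyn T k \<in> stat_space T k \<Otimes>\<^sub>M acts_space T (down T k) \<rightarrow>\<^sub>M obs_space T k"
      using sub assms(1) by (auto simp: stochastic_team_def)
    have s: "(\<lambda>x. fst x k) \<in> ?S \<Otimes>\<^sub>M ?A \<rightarrow>\<^sub>M stat_space T k"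
      by (rule measurable_compose[OF measurable_fst measurable_component_singleton[OF k]])
    have v: "(\<lambda>x. restrict (snd x) (down T k)) \<in> ?S \<Otimes>\<^sub>M ?A \<rightarrow>\<^sub>M acts_space T (down T k)"
      unfolding acts_space_def
      by (rule measurable_compose[OF measurable_snd measurable_restrict_subset]) (use sub in blast)
    show ?thesis
      by (rule measurable_compose[OF measurable_Pair[OF s v] d])
  qed
  then show ?thesis
    unfolding dynamic_info_def case_prod_beta
    by (intro measurable_Pair measurable_restrict measurable_snd)
qed

theorem theorem5p1:
  fixes T :: "('w, 'z::polish_space) team"
  assumes "stochastic_team T"
    and "partially_nested T"
    and "invertible_observations T"
  shows "\<exists>R. static_CS_reduction T R \<and> policy_independent T R \<and>
    (\<forall>R'. static_CS_reduction T R' \<longrightarrow>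
      (\<forall>\<gamma>\<in>policies_DCS T. \<forall>i\<in>DMs T. \<forall>u\<in>space (acts_space T (down T i)).
        AE \<omega> in base T. R' \<gamma> i (y_CS T i \<omega> u) = R \<gamma> i (y_CS T i \<omega> u)))"
proof -
  define R :: "(nat \<Rightarrow> policy) \<Rightarrow> nat \<Rightarrow> policy"
    where "R \<gamma> i = (\<lambda>y. \<gamma> i (dynamic_info T i y))" for \<gamma> i
  have R_y_CS: "R \<gamma> i (y_CS T i \<omega> u) = \<gamma> i (y_DCS T i \<omega> u)" if "i \<in> DMs T" for \<gamma> i \<omega> u
    using dynamic_info_y_CS[OF assms(1,2) that] by (simp add: R_def)
  have "R \<gamma> \<in> policies_CS T" if "\<gamma> \<in> policies_DCS T" for \<gamma>
    using that measurable_compose[OF measurable_dynamic_info[OF assms(1,2)]]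
    by (auto simp: policies_DCS_def policies_CS_def R_def)
  then have "static_CS_reduction T R"
    by (simp add: static_CS_reduction_def R_y_CS)
  moreover have "policy_independent T R"
    \<comment> \<open>The witness \<open>C\<close> is precomposition with
      \<open>dynamic_info T i\<close>; its argument \<open>p\<close> stands for
      \<open>\<gamma> i\<close> alone.\<close>
    unfolding policy_independent_def R_def
    by (rule exI[of _ "\<lambda>i p y. p (dynamic_info T i y)"]) simp
  moreover have "AE \<omega> in base T. R' \<gamma> i (y_CS T i \<omega> u) = R \<gamma> i (y_CS T i \<omega> u)"
    if "static_CS_reduction T R'" "\<gamma> \<in> policies_DCS T" "i \<in> DMs T"
      "u \<in> space (acts_space T (down T i))" for R' \<gamma> i u
    \<comment> \<open>\<open>R_y_CS\<close> turns the right side into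
      \<open>\<gamma> i (y_DCS T i \<omega> u)\<close>, which leaves the defining equation of
      \<open>R'\<close> reversed.\<close>
    using that by (simp add: static_CS_reduction_def R_y_CS eq_commute)
  ultimately show ?thesis by blast
qed

end
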